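(* Let $n_x,n_r,n_b$ be positive integers with $n_r<n_x$. Let $Q\in\mathbb{R}^{n_x\times n_x}$ be diagonal and positive definite, let $S\in\mathbb{R}^{n_r\times n_x}$ and $W_b\in\mathbb{R}^{n_r\times n_b}$ have full row rank, let $\mathcal{T}_x\in\mathbb{R}^{n_x\times n_x}$ and $\mathcal{T}_\nu\in\mathbb{R}^{n_r\times n_r}$ be diagonal and positive definite, let $t_b,t_c\ge 0$, and let $\epsilon>0$. Consider the input-output regularized saddle-point system $G_{\rm reg}$ with state $(x,\nu)\in\mathbb{R}^{n_x}\times\mathbb{R}^{n_r}$, input $(\eta_c,\eta_b)\in\mathbb{R}^{n_x}\times\mathbb{R}^{n_b}$ and output $z\in\mathbb{R}^{n_x}$ given by $$\mathcal{T}_x\dot x=-Qx-S^{\sf T}\nu-t_c\,\eta_c,\qquad \mathcal{T}_\nu\dot\nu=Sx-\epsilon\nu-t_b W_b\,\eta_b,\qquad z=Q^{1/2}x .$$ Then its squared $\mathcal{H}_2$ norm satisfies the strict inequality $$\|G_{\rm reg}\|_{\mathcal{H}_2}^2<\frac{t_c^2}{2}\,\mathrm{Tr}\big(\mathcal{T}_x^{-1}\big)+\frac{t_b^2}{2}\,\mathrm{Tr}\big(W_b^{\sf T}\mathcal{T}_\nu^{-1}W_b\big).$$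
   Context: For an input-output stable LTI system $\dot\xi=A\xi+B\eta$, $z=C\xi$, the $\mathcal{H}_2$ norm from $\eta$ to $z$ is defined by $\|G\|_{\mathcal{H}_2}^2=\frac{1}{2\pi}\int_{-\infty}^{\infty}\mathrm{Tr}\big(G(-j\omega)^{\sf T}G(j\omega)\big)\,d\omega$ with $G(j\omega)=C(j\omega I-A)^{-1}B$. If $A$ is Hurwitz, then $\|G\|_{\mathcal{H}_2}^2=\mathrm{Tr}(B^{\sf T}XB)$, where $X=X^{\sf T}\succeq 0$ is the unique solution of $A^{\sf T}X+XA+C^{\sf T}C=0$. The system models the saddle-point algorithm for the regularized Lagrangian $\frac12x^{\sf T}Qx+c^{\sf T}x+\nu^{\sf T}(Sx-W_bb)-\frac{\epsilon}{2}\|\nu\|_2^2$, with disturbances $b\mapsto b+t_b\eta_b$, $c\mapsto c+t_c\eta_c$, in coordinates shifted to the equilibrium; the scalars $t_b,t_c$ parameterize the strengths of the disturbances. The right-hand side of the inequality is the squared $\mathcal{H}_2$ norm of the unregularized system ($\epsilon=0$).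
   Formalization: The case t_b = t_c = 0 is excluded: there the input matrix vanishes, so both sides of the inequality equal 0 and the strict inequality fails. *)

theory Defs
  imports "HOL-Analysis.Analysis"
begin

subsection \<open>Matrices\<close>

definition is_diagonal :: "real^'n^'n \<Rightarrow> bool" where
  "is_diagonal M \<longleftrightarrow> (\<forall>i j. i \<noteq> j \<longrightarrow> M $ i $ j = 0)"

definition pos_definite :: "real^'n^'n \<Rightarrow> bool" where
  "pos_definite M \<longleftrightarrow> transpose M = M \<and> (\<forall>x. x \<noteq> 0 \<longrightarrow> x \<bullet> (M *v x) > 0)"

definition pos_semidefinite :: "real^'n^'n \<Rightarrow> bool" where
  "pos_semidefinite M \<longleftrightarrow> transpose M = M \<and> (\<forall>x. x \<bullet> (M *v x) \<ge> 0)"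

definition full_row_rank :: "real^'n^'m \<Rightarrow> bool" where
  "full_row_rank (M :: real^'n^'m) \<longleftrightarrow> rank M = CARD('m)"

text \<open>The principal square root. Existence and uniqueness for diagonal positive definite matrices
  is shown in lemma \<open>psd_sqrt_diagonal\<close> below.\<close>

definition psd_sqrt :: "real^'n^'n \<Rightarrow> real^'n^'n" where
  "psd_sqrt M = (THE R. pos_semidefinite R \<and> R ** R = M)"

text \<open>Block vectors and matrices are indexed by disjoint sums.\<close>

definition block_vec :: "'a^'m \<Rightarrow> 'a^'n \<Rightarrow> 'a^('m + 'n)" where
  "block_vec u v = (\<chi> i. case i of Inl k \<Rightarrow> u $ k | Inr k \<Rightarrow> v $ k)"

definition block_row :: "'a^'m^'p \<Rightarrow> 'a^'n^'p \<Rightarrow> 'a^('m + 'n)^'p" where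
  "block_row M N = (\<chi> i. block_vec (M $ i) (N $ i))"

definition block_mat ::
  "'a^'m^'p \<Rightarrow> 'a^'n^'p \<Rightarrow> 'a^'m^'q \<Rightarrow> 'a^'n^'q \<Rightarrow> 'a^('m + 'n)^('p + 'q)" where
  "block_mat M11 M12 M21 M22 = block_vec (block_row M11 M12) (block_row M21 M22)"


subsection \<open>LTI systems $\dot\xi = A\xi + B\eta$, $z = C\xi$\<close>

definition transfer_function ::
  "real^'s^'s \<Rightarrow> real^'m^'s \<Rightarrow> real^'s^'p \<Rightarrow> complex \<Rightarrow> complex^'m^'p" where
  "transfer_function A B C s =
     map_matrix of_real C ** matrix_inv (mat s - map_matrix of_real A) ** map_matrix of_real B"

text \<open>Input-output stability: the transfer function is bounded on the closed right half plane.
  The eigenvalues of \<open>A\<close>, where \<open>matrix_inv\<close> carries no information, are left out. They are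
  finitely many, and a strictly proper rational function is unbounded near each of its poles and
  tends to zero at infinity, so this says that \<open>G\<close> has no pole with nonnegative real part.\<close>

definition io_stable :: "real^'s^'s \<Rightarrow> real^'m^'s \<Rightarrow> real^'s^'p \<Rightarrow> bool" where
  "io_stable A B C \<longleftrightarrow>
     bounded (transfer_function A B C ` {s. Re s \<ge> 0 \<and> invertible (mat s - map_matrix of_real A)})"

text \<open>The trace in the integrand is real, because \<open>G(-j\<omega>)\<close> is the complex conjugate of \<open>G(j\<omega>)\<close>;
  \<open>Re\<close> only changes its type. The value is meaningful for \<open>io_stable\<close> systems, for which
  the integrand is Lebesgue integrable.\<close>

definition H2_norm :: "real^'s^'s \<Rightarrow> real^'m^'s \<Rightarrow> real^'s^'p \<Rightarrow> real" where
  "H2_norm A B C =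
     sqrt (1 / (2 * pi) *
       (LBINT w. Re (trace (transpose (transfer_function A B C (- (\<i> * of_real w))) **
                            transfer_function A B C (\<i> * of_real w)))))"


subsection \<open>The regularized saddle-point system\<close>

text \<open>State \<open>(x, \<nu>)\<close>, input \<open>(\<eta>\<^sub>c, \<eta>\<^sub>b)\<close>, output \<open>Q\<^sup>1\<^sup>/\<^sup>2 x\<close>.
  Lemma \<open>reg_dynamics\<close> relates these matrices to the implicit equations of motion.\<close>

definition reg_A ::
  "real^'x^'x \<Rightarrow> real^'x^'r \<Rightarrow> real^'x^'x \<Rightarrow> real^'r^'r \<Rightarrow> real \<Rightarrow> real^('x + 'r)^('x + 'r)" where
  "reg_A Q S Tx Tn eps =
     block_mat (- (matrix_inv Tx ** Q)) (- (matrix_inv Tx ** transpose S))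
               (matrix_inv Tn ** S)     (- (eps *\<^sub>R matrix_inv Tn))"

definition reg_B ::
  "real^'x^'x \<Rightarrow> real^'r^'r \<Rightarrow> real^'b^'r \<Rightarrow> real \<Rightarrow> real \<Rightarrow> real^('x + 'b)^('x + 'r)" where
  "reg_B Tx Tn Wb tb tc =
     block_mat (- (tc *\<^sub>R matrix_inv Tx)) 0
               0 (- (tb *\<^sub>R (matrix_inv Tn ** Wb)))"

definition reg_C :: "real^'x^'x \<Rightarrow> real^('x + 'r::finite)^'x" where
  "reg_C Q = block_row (psd_sqrt Q) 0"


subsection \<open>Consistency of the definitions\<close>

lemma UNIV_sum_split:
  "(\<Sum>i\<in>(UNIV :: ('m::finite + 'n::finite) set). f i) = (\<Sum>k\<in>UNIV. f (Inl k)) + (\<Sum>k\<in>UNIV. f (Inr k))"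
  by (simp add: UNIV_Plus_UNIV[symmetric] sum.Plus del: UNIV_Plus_UNIV)

lemma block_vec_add: "block_vec u v + block_vec u' v' = block_vec (u + u') (v + v')"
  by (simp add: block_vec_def vec_eq_iff split: sum.split)

lemma block_vec_nth [simp]: "block_vec u v $ Inl k = u $ k" "block_vec u v $ Inr l = v $ l"
  by (simp_all add: block_vec_def)

lemma block_vec_eq_iff: "block_vec u v = block_vec u' v' \<longleftrightarrow> u = u' \<and> v = v'"
  by (metis block_vec_nth vec_eq_iff)

lemma block_row_mult: "block_row M N *v block_vec u v = M *v u + N *v v"
  by (simp add: block_row_def block_vec_def matrix_vector_mult_def vec_eq_iff UNIV_sum_split)

lemma block_mat_mult:
  "block_mat M11 M12 M21 M22 *v block_vec u v = block_vec (M11 *v u + M12 *v v) (M21 *v u + M22 *v v)"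
  by (auto simp: block_mat_def block_row_def block_vec_def matrix_vector_mult_def vec_eq_iff
      UNIV_sum_split split: sum.split)

lemma pos_definite_invertible:
  assumes "pos_definite M"
  shows "invertible M"
proof -
  have "x = 0" if "M *v x = 0" for x
    using assms that unfolding pos_definite_def by (metis inner_zero_right less_irrefl)
  then show ?thesis
    by (metis invertible_left_inverse matrix_left_invertible_ker)
qed

lemma matrix_inv_cancel:
  fixes M :: "real^'n^'n"
  assumes "invertible M"
  shows "y = matrix_inv M *v u \<longleftrightarrow> M *v y = u"
proof -
  have "M ** matrix_inv M = mat 1 \<and> matrix_inv M ** M = mat 1"
    unfolding matrix_inv_def using assms unfolding invertible_def by (rule someI_ex)
  then show ?thesis
    by (metis matrix_vector_mul_assoc matrix_vector_mul_lid)
qed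

lemma reg_dynamics:
  fixes Q Tx :: "real^'x^'x" and S :: "real^'x^'r" and Tn :: "real^'r^'r" and Wb :: "real^'b^'r"
  assumes "pos_definite Tx" and "pos_definite Tn"
  shows "block_vec dx dn
           = reg_A Q S Tx Tn eps *v block_vec x n + reg_B Tx Tn Wb tb tc *v block_vec hc hb \<longleftrightarrow>
         Tx *v dx = - (Q *v x) - transpose S *v n - tc *\<^sub>R hc \<and>
         Tn *v dn = S *v x - eps *\<^sub>R n - tb *\<^sub>R (Wb *v hb)"
proof -
  have neg: "(- M) *v u = M *v (- u)" for M :: "real^'i^'j" and u
    by (simp add: matrix_vector_mult_def vec_eq_iff)
  have sc: "(c *\<^sub>R M) *v u = M *v (c *\<^sub>R u)" for M :: "real^'i^'j" and u c
    by (simp add: matrix_vector_mult_def vec_eq_iff algebra_simps)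
  have mr: "M *v (- u) = - (M *v u)" for M :: "real^'i^'j" and u
    by (simp add: matrix_vector_mult_def vec_eq_iff sum_negf)
  have 1: "(- (matrix_inv Tx ** Q)) *v x + (- (matrix_inv Tx ** transpose S)) *v n
           + (- (tc *\<^sub>R matrix_inv Tx)) *v hc
         = matrix_inv Tx *v (- (Q *v x) - transpose S *v n - tc *\<^sub>R hc)"
    by (simp add: neg sc mr matrix_vector_mul_assoc[symmetric] matrix_vector_mult_diff_distrib
        matrix_vector_mult_scaleR)
  have 2: "(matrix_inv Tn ** S) *v x + (- (eps *\<^sub>R matrix_inv Tn)) *v n
           + (- (tb *\<^sub>R (matrix_inv Tn ** Wb))) *v hb
         = matrix_inv Tn *v (S *v x - eps *\<^sub>R n - tb *\<^sub>R (Wb *v hb))"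
    by (simp add: neg sc mr matrix_vector_mul_assoc[symmetric] matrix_vector_mult_diff_distrib
        matrix_vector_mult_scaleR)
  show ?thesis
    by (simp add: reg_A_def reg_B_def block_mat_mult block_vec_add block_vec_eq_iff 1 2
        matrix_inv_cancel pos_definite_invertible assms)
qed

lemma reg_output: "reg_C Q *v block_vec x n = psd_sqrt Q *v x"
  by (simp add: reg_C_def block_row_mult)

lemma psd_sqrt_diagonal:
  fixes Q :: "real^'n^'n"
  assumes diag: "is_diagonal Q" and pd: "pos_definite Q"
  shows "pos_semidefinite R \<and> R ** R = Q \<longleftrightarrow> R = psd_sqrt Q"
    and "psd_sqrt Q = (\<chi> i j. sqrt (Q $ i $ j))"
proof -
  define D :: "real^'n^'n" where "D = (\<chi> i j. sqrt (Q $ i $ j))"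
  define q where "q i = Q $ i $ i" for i
  have Q_entry: "Q $ i $ j = (if i = j then q i else 0)" for i j
    using diag by (simp add: is_diagonal_def q_def)
  have D_entry: "D $ i $ j = (if i = j then sqrt (q i) else 0)" for i j
    by (simp add: D_def Q_entry)
  have Dv: "(D *v x) $ i = sqrt (q i) * x $ i" for x i
    by (simp add: matrix_vector_mult_def D_entry mult_delta_left)
  have Qv: "(Q *v x) $ i = q i * x $ i" for x i
    by (simp add: matrix_vector_mult_def Q_entry mult_delta_left)
  have q: "q i > 0" for i
  proof -
    have "axis i 1 \<bullet> (Q *v axis i (1::real)) > 0"
      using pd by (simp add: pos_definite_def)
    then show ?thesis
      by (simp add: inner_axis' Qv)
  qed
  have quad: "x \<bullet> (D *v x) = (\<Sum>i\<in>UNIV. sqrt (q i) * (x $ i)\<^sup>2)" for x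
    by (simp add: inner_vec_def Dv power2_eq_square algebra_simps)
  have D_pos: "x \<bullet> (D *v x) > 0" if x: "x \<noteq> 0" for x
  proof -
    obtain k where "x $ k \<noteq> 0"
      using x by (auto simp: vec_eq_iff)
    then have "0 < sqrt (q k) * (x $ k)\<^sup>2"
      using q by simp
    also have "\<dots> \<le> (\<Sum>i\<in>UNIV. sqrt (q i) * (x $ i)\<^sup>2)"
      by (rule member_le_sum) (auto intro!: mult_nonneg_nonneg less_imp_le[OF q])
    finally show ?thesis
      by (simp add: quad)
  qed
  have D_psd: "pos_semidefinite D"
    unfolding pos_semidefinite_def
  proof
    show "transpose D = D"
      by (auto simp: transpose_def vec_eq_iff D_entry)
    show "\<forall>x. 0 \<le> x \<bullet> (D *v x)"
      proof
      show "0 \<le> x \<bullet> (D *v x)" for x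
        using D_pos[of x] by (cases "x = 0") auto
    qed
  qed
  have DD: "D ** D = Q"
  proof -
    have "(D ** D) *v x = Q *v x" for x
      using q by (simp add: vec_eq_iff matrix_vector_mul_assoc[symmetric] Dv Qv
          less_imp_le flip: mult.assoc)
    then show ?thesis
      by (simp add: matrix_eq)
  qed
  have uniq: "R = D" if R: "pos_semidefinite R" "R ** R = Q" for R
  proof -
    have QR: "(Q ** R) $ i $ j = q i * R $ i $ j" for i j
      by (simp add: matrix_matrix_mult_def Q_entry mult_delta_left)
    have RQ: "(R ** Q) $ i $ j = R $ i $ j * q j" for i j
      by (simp add: matrix_matrix_mult_def Q_entry mult_delta_right)
    have "Q ** R = R ** Q"
      by (subst (1 2) R(2)[symmetric]) (rule matrix_mul_assoc[symmetric])
    then have comm: "q i * R $ i $ j = R $ i $ j * q j" for i j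
      by (subst QR[symmetric], subst RQ[symmetric]) (erule ssubst, rule refl)
    have entry: "sqrt (q i) * R $ i $ j = R $ i $ j * sqrt (q j)" for i j
      using comm[of i j] by (cases "R $ i $ j = 0") (simp_all add: mult.commute)
    have DR: "D ** R = R ** D"
      by (simp add: vec_eq_iff matrix_matrix_mult_def D_entry mult_delta_left mult_delta_right entry)
    have "R *v x = D *v x" for x
    proof -
      define y where "y = R *v x - D *v x"
      have "R *v y + D *v y = (R ** R) *v x - (D ** D) *v x"
        by (simp add: y_def matrix_vector_mult_diff_distrib matrix_vector_mul_assoc DR)
      then have "y \<bullet> (R *v y) + y \<bullet> (D *v y) = 0"
        unfolding R(2) DD inner_add_right[symmetric] by (simp only: diff_self inner_zero_right)
      moreover have "0 \<le> y \<bullet> (R *v y)"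
        using R(1) by (simp add: pos_semidefinite_def)
      ultimately have "y = 0"
        using D_pos[of y] by fastforce
      then show ?thesis
        by (simp add: y_def)
    qed
    then show ?thesis
      by (simp add: matrix_eq)
  qed
  have eq: "psd_sqrt Q = D"
    unfolding psd_sqrt_def using D_psd DD uniq by (intro the_equality) blast+
  show "psd_sqrt Q = (\<chi> i j. sqrt (Q $ i $ j))"
    by (simp add: eq D_def)
  show "pos_semidefinite R \<and> R ** R = Q \<longleftrightarrow> R = psd_sqrt Q"
    unfolding eq using D_psd DD uniq by blast
qed

end

theory Submission
  imports Defs "HOL-Complex_Analysis.Cauchy_Integral_Theorem"
begin

text \<open>Append to the output \<open>z = Q\<^sup>1\<^sup>/\<^sup>2 x\<close> the second output \<open>\<epsilon>\<^sup>1\<^sup>/\<^sup>2 \<nu>\<close>. For the enlarged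
  output the Lyapunov equation is solved by \<open>P = diag(\<T>\<^sub>x, \<T>\<^sub>\<nu>) / 2\<close>, so the squared \<open>H\<^sub>2\<close> norms of
  the two outputs add up to \<open>Tr(B\<^sup>T P B)\<close>, which is the right-hand side of the claim. The norm of the
  second output is positive because some constant input has an equilibrium with \<open>\<nu> \<noteq> 0\<close>.

  The \<open>H\<^sub>2\<close> norms are computed in the frequency domain. Along \<open>\<xi>(s) = (s - A)\<^sup>-\<^sup>1 b\<close> the Lyapunov equation
  turns the output energy at \<open>s = j\<omega>\<close> into \<open>2 Re (b\<^sup>T P \<xi>(j\<omega>))\<close>. The function \<open>b\<^sup>T P \<xi>(s)\<close> is holomorphic on
  the closed right half plane and equals \<open>(b\<^sup>T P b) / s + O(1 / s\<^sup>2)\<close>, so by Cauchy's theorem its integral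
  over the imaginary axis agrees with that of \<open>(b\<^sup>T P b) / (s + 1)\<close>.\<close>

subsection \<open>Integration along the imaginary axis\<close>

lemma segment_increment_le:
  fixes H h :: "complex \<Rightarrow> complex"
  assumes "\<And>z. z \<in> closed_segment a b \<Longrightarrow> (H has_field_derivative h z) (at z within T)"
    and "closed_segment a b \<subseteq> T"
    and "\<And>z. z \<in> closed_segment a b \<Longrightarrow> norm (h z) \<le> M"
  shows "norm (H b - H a) \<le> M * norm (b - a)"
  using assms
  by (intro field_differentiable_bound[where S = "closed_segment a b" and f' = h])
     (auto intro: has_field_derivative_subset)

text \<open>A contour estimate phrased through a primitive: the increment from -iR to iR is
  collected along the other three sides of the rectangle with corners -iR, R - iR, R + iR, iR. All
  their points have modulus at least R, so \<open>h\<close> is at most K / R^2 there, and their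
  total length is 4 R.\<close>

lemma primitive_increment_imaginary_axis:
  fixes H h :: "complex \<Rightarrow> complex"
  assumes H: "\<And>z. Re z \<ge> 0 \<Longrightarrow> (H has_field_derivative h z) (at z within {z. Re z \<ge> 0})"
    and bound: "\<And>z. Re z \<ge> 0 \<Longrightarrow> norm z \<ge> r \<Longrightarrow> norm (h z) \<le> K / (norm z)\<^sup>2"
    and R: "R \<ge> r" "R > 0" and K: "K \<ge> 0"
  shows "norm (H (\<i> * of_real R) - H (- (\<i> * of_real R))) \<le> 4 * K / R"
proof -
  define a b c d where "a = - (\<i> * of_real R)" and "b = of_real R - \<i> * of_real R"
    and "c = of_real R + \<i> * of_real R" and "d = \<i> * of_real R"
  note abcd = a_def b_def c_def d_def
  \<comment> \<open>Each side is enclosed in a convex set \<open>U\<close> inside the right half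
    plane and outside the open disc of radius R, so that only its endpoints need checking.\<close>
  have step: "norm (H y - H x) \<le> K / R\<^sup>2 * norm (y - x)"
    if seg: "closed_segment x y \<subseteq> U" and U: "\<And>z. z \<in> U \<Longrightarrow> Re z \<ge> 0 \<and> norm z \<ge> R" for x y U
  proof (rule segment_increment_le[where T = "{z. Re z \<ge> 0}" and h = h])
    show "(H has_field_derivative h z) (at z within {z. 0 \<le> Re z})" if "z \<in> closed_segment x y" for z
      using that seg U H by blast
    show "closed_segment x y \<subseteq> {z. 0 \<le> Re z}"
      using seg U by blast
    fix z assume "z \<in> closed_segment x y"
    then have z: "Re z \<ge> 0" "norm z \<ge> R"
      using seg U by blast+
    then have "norm (h z) \<le> K / (norm z)\<^sup>2"
      using bound R by simp
    also have "\<dots> \<le> K / R\<^sup>2"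
      using z R K by (intro divide_left_mono power_mono mult_pos_pos zero_less_power) auto
    finally show "norm (h z) \<le> K / R\<^sup>2" .
  qed
  have conv: "closed_segment x y \<subseteq> U" if "convex U" "x \<in> U" "y \<in> U" for x y and U :: "complex set"
    using that by (simp add: closed_segment_subset)
  have 1: "norm (H b - H a) \<le> K / R\<^sup>2 * norm (b - a)"
  proof (rule step[where U = "{z. Re z \<ge> 0} \<inter> {z. Im z \<le> - R}"])
    show "Re z \<ge> 0 \<and> norm z \<ge> R" if "z \<in> {z. Re z \<ge> 0} \<inter> {z. Im z \<le> - R}" for z
      using that abs_Im_le_cmod[of z] by auto
  qed (intro conv convex_Int convex_halfspace_Re_ge convex_halfspace_Im_le; use R in \<open>simp add: abcd\<close>)
  have 2: "norm (H c - H b) \<le> K / R\<^sup>2 * norm (c - b)"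
  proof (rule step[where U = "{z. Re z \<ge> R}"])
    show "Re z \<ge> 0 \<and> norm z \<ge> R" if "z \<in> {z. Re z \<ge> R}" for z
      using that R abs_Re_le_cmod[of z] by auto
  qed (intro conv convex_halfspace_Re_ge; use R in \<open>simp add: abcd\<close>)
  have 3: "norm (H d - H c) \<le> K / R\<^sup>2 * norm (d - c)"
  proof (rule step[where U = "{z. Re z \<ge> 0} \<inter> {z. Im z \<ge> R}"])
    show "Re z \<ge> 0 \<and> norm z \<ge> R" if "z \<in> {z. Re z \<ge> 0} \<inter> {z. Im z \<ge> R}" for z
      using that abs_Im_le_cmod[of z] by auto
  qed (intro conv convex_Int convex_halfspace_Re_ge convex_halfspace_Im_ge; use R in \<open>simp add: abcd\<close>)
  have len: "norm (b - a) = R" "norm (c - b) = 2 * R" "norm (d - c) = R"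
    using R by (simp_all add: abcd norm_mult flip: mult_2)
  have "norm (H d - H a) \<le> norm (H b - H a) + norm (H c - H b) + norm (H d - H c)"
    by norm
  also have "\<dots> \<le> K / R\<^sup>2 * R + K / R\<^sup>2 * (2 * R) + K / R\<^sup>2 * R"
    using 1 2 3 unfolding len by linarith
  also have "\<dots> = 4 * K / R"
    using R by (simp add: field_simps power2_eq_square)
  finally show ?thesis
    by (simp add: a_def d_def)
qed

text \<open>The truncations to [-n, n] increase because \<open>g\<close> is nonnegative, so monotone
  convergence upgrades a symmetric improper integral to a Lebesgue integral and yields integrability
  as well.\<close>

lemma has_bochner_integral_exhaustion:
  fixes g G :: "real \<Rightarrow> real"
  assumes G: "\<And>x. (G has_real_derivative g x) (at x)"
    and cont: "continuous_on UNIV g" and nonneg: "\<And>x. g x \<ge> 0"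
    and lim: "(\<lambda>n. G (real n) - G (- real n)) \<longlonglongrightarrow> L"
  shows "has_bochner_integral lborel g L"
proof -
  define f where "f n x = indicator {- real n..real n} x *\<^sub>R g x" for n x
  have int: "integrable lborel (f n)" for n
    using borel_integrable_atLeastAtMost'[OF continuous_on_subset[OF cont subset_UNIV]]
    unfolding f_def set_integrable_def by blast
  have val: "integral\<^sup>L lborel (f n) = G (real n) - G (- real n)" for n
    unfolding f_def
    by (intro integral_FTC_atLeastAtMost continuous_on_subset[OF cont] subset_UNIV)
       (auto intro: has_field_derivative_at_within G simp flip: has_real_derivative_iff_has_vector_derivative)
  have mono: "mono (\<lambda>n. f n x)" for x
    by (intro monoI) (auto simp: f_def nonneg indicator_def)
  have pt: "(\<lambda>n. f n x) \<longlonglongrightarrow> g x" for x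
  proof (rule tendsto_eventually)
    show "\<forall>\<^sub>F n in sequentially. f n x = g x"
      using eventually_ge_at_top[of "nat \<lceil>\<bar>x\<bar>\<rceil>"]
      by eventually_elim (auto simp: f_def indicator_def abs_le_iff; linarith)
  qed
  have "integrable lborel g" "integral\<^sup>L lborel g = L"
    by (rule integral_monotone_convergence_nonneg[where f = f and u = g];
        use int mono pt nonneg lim cont in
          \<open>simp add: val f_def borel_measurable_continuous_onI\<close>)+
  then show ?thesis
    by (simp add: has_bochner_integral_iff)
qed

text \<open>Subtracting c / (z + 1) removes the 1 / z tail without placing a pole in the closed half
  plane. The remainder \<open>h\<close> is O(1 / |z|^2), so its primitive has vanishing increments
  between -in and in. The whole value comes from Re (c / (1 + iw)) = c / (1 + w^2), whose integral
  is pi c.\<close>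

lemma has_bochner_integral_Re_imaginary_axis:
  fixes f :: "complex \<Rightarrow> complex" and c K r :: real
  assumes hol: "f holomorphic_on {z. Re z \<ge> 0}"
    and bound: "\<And>z. Re z \<ge> 0 \<Longrightarrow> norm z \<ge> r \<Longrightarrow> norm (f z - of_real c / z) \<le> K / (norm z)\<^sup>2"
    and r: "r > 0" and K: "K \<ge> 0"
    and nonneg: "\<And>w. Re (f (\<i> * of_real w)) \<ge> 0"
  shows "has_bochner_integral lborel (\<lambda>w. Re (f (\<i> * of_real w))) (pi * c)"
proof -
  let ?S = "{z. Re z \<ge> 0}"
  define h where "h z = f z - of_real c / (z + 1)" for z
  have ne: "z + 1 \<noteq> 0" if "Re z \<ge> 0" for z :: complex
    using that by (metis add_nonneg_pos less_irrefl one_complex.sel(1) plus_complex.sel(1) zero_complex.sel(1) zero_less_one)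
  have h_hol: "h holomorphic_on ?S"
    unfolding h_def using ne by (intro holomorphic_intros hol) auto
  have h_bound: "norm (h z) \<le> (K + \<bar>c\<bar>) / (norm z)\<^sup>2" if z: "Re z \<ge> 0" "norm z \<ge> r" for z
  proof -
    have z0: "z \<noteq> 0"
      using z r by auto
    have "norm z \<le> norm (z + 1)"
      using z by (auto simp: cmod_def power2_eq_square algebra_simps intro!: real_sqrt_le_mono)
    then have "(norm z)\<^sup>2 \<le> norm z * norm (z + 1)"
      by (simp add: power2_eq_square mult_left_mono)
    then have *: "\<bar>c\<bar> / (norm z * norm (z + 1)) \<le> \<bar>c\<bar> / (norm z)\<^sup>2"
      using z0 by (intro divide_left_mono) (auto simp: ne z)
    \<comment> \<open>Exchanging c / z for c / (z + 1) costs only a term of second order.\<close>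
    have "of_real c / (z * (z + 1)) = of_real c / z - of_real c / (z + 1)"
      using z0 ne[OF z(1)] by (simp add: diff_frac_eq algebra_simps)
    then have "h z = (f z - of_real c / z) + of_real c / (z * (z + 1))"
      by (simp add: h_def)
    then have "norm (h z) \<le> norm (f z - of_real c / z) + norm (of_real c / (z * (z + 1)))"
      by (metis norm_triangle_ineq)
    also have "\<dots> \<le> K / (norm z)\<^sup>2 + \<bar>c\<bar> / (norm z)\<^sup>2"
      using bound[OF z] * by (simp add: norm_divide norm_mult)
    finally show ?thesis
      by (simp add: add_divide_distrib)
  qed
  obtain H where H: "\<And>z. Re z \<ge> 0 \<Longrightarrow> (H has_field_derivative h z) (at z within ?S)"
  proof (rule holomorphic_convex_primitive[of ?S "{}" h])
    show "convex ?S"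
      by (rule convex_halfspace_Re_ge)
    show "continuous_on ?S h"
      using h_hol by (rule holomorphic_on_imp_continuous_on)
    show "h field_differentiable at z" if "z \<in> interior ?S - {}" for z
      using holomorphic_on_imp_differentiable_at[OF holomorphic_on_subset[OF h_hol interior_subset]] that
      by auto
  qed auto
  \<comment> \<open>A real primitive of Re f along the axis: dividing by i undoes the chain rule
    factor of w -> iw, and the arctangent accounts for the subtracted c / (z + 1).\<close>
  define G where "G w = Re (H (\<i> * of_real w) / \<i>) + c * arctan w" for w
  have f_cont: "continuous_on UNIV (\<lambda>w. Re (f (\<i> * of_real w)))"
    by (intro continuous_intros continuous_on_compose2[OF holomorphic_on_imp_continuous_on[OF hol]]) auto
  have G: "(G has_real_derivative Re (f (\<i> * of_real w))) (at w)" for w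
  proof -
    have 1: "((\<lambda>w. \<i> * of_real w) has_vector_derivative \<i>) (at w)"
      using has_vector_derivative_mult_right[OF has_vector_derivative_of_real[OF DERIV_ident]] by simp
    have "((H \<circ> (\<lambda>w. \<i> * of_real w)) has_vector_derivative \<i> * h (\<i> * of_real w)) (at w)"
      by (rule field_vector_diff_chain_within[OF 1])
         (rule has_field_derivative_subset[OF H]; auto)
    then have "((\<lambda>w. Re (H (\<i> * of_real w) / \<i>)) has_vector_derivative Re (\<i> * h (\<i> * of_real w) / \<i>)) (at w)"
      unfolding o_def
      by (intro bounded_linear.has_vector_derivative[OF bounded_linear_Re]
            bounded_linear.has_vector_derivative[OF bounded_linear_divide])
    then have "((\<lambda>w. Re (H (\<i> * of_real w) / \<i>)) has_real_derivative Re (h (\<i> * of_real w))) (at w)"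
      by (simp only: has_real_derivative_iff_has_vector_derivative nonzero_mult_div_cancel_left[OF complex_i_not_zero])
    then have "(G has_real_derivative Re (h (\<i> * of_real w)) + c * inverse (1 + w\<^sup>2)) (at w)"
      unfolding G_def by (rule DERIV_add[OF _ DERIV_cmult[OF DERIV_arctan]])
    moreover have "Re (of_real c / (\<i> * of_real w + 1)) = c * inverse (1 + w\<^sup>2)"
      by (simp add: Re_divide divide_inverse)
    ultimately show ?thesis
      by (simp add: h_def)
  qed
  have "(\<lambda>n. G (real n) - G (- real n)) \<longlonglongrightarrow> 0 + (c * (pi / 2) - c * (- (pi / 2)))"
  proof -
    have "(\<lambda>n. Re ((H (\<i> * of_real (real n)) - H (- (\<i> * of_real (real n)))) / \<i>)) \<longlonglongrightarrow> 0"
    proof (rule Lim_null_comparison)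
      show "\<forall>\<^sub>F n in sequentially.
          norm (Re ((H (\<i> * of_real (real n)) - H (- (\<i> * of_real (real n)))) / \<i>)) \<le> 4 * (K + \<bar>c\<bar>) / real n"
        using eventually_ge_at_top[of "nat \<lceil>r\<rceil>"]
      proof eventually_elim
        case (elim n)
        then have n: "real n \<ge> r"
          by linarith
        have "norm (Re ((H (\<i> * of_real (real n)) - H (- (\<i> * of_real (real n)))) / \<i>))
            \<le> norm ((H (\<i> * of_real (real n)) - H (- (\<i> * of_real (real n)))) / \<i>)"
          by (metis abs_Re_le_cmod real_norm_def)
        also have "\<dots> \<le> 4 * (K + \<bar>c\<bar>) / real n"
          unfolding norm_divide norm_ii div_by_1
          by (rule primitive_increment_imaginary_axis[OF H h_bound]) (use n r K in auto)
        finally show ?case .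
      qed
      show "(\<lambda>n. 4 * (K + \<bar>c\<bar>) / real n) \<longlonglongrightarrow> 0"
        by (rule lim_const_over_n)
    qed
    moreover have "(\<lambda>n. c * arctan (real n) - c * arctan (- real n)) \<longlonglongrightarrow> c * (pi / 2) - c * (- (pi / 2))"
      by (intro tendsto_intros filterlim_compose[OF tendsto_arctan_at_top filterlim_real_sequentially]
            filterlim_compose[OF tendsto_arctan_at_bot]
            filterlim_compose[OF filterlim_uminus_at_bot_at_top filterlim_real_sequentially])
    ultimately have "(\<lambda>n. Re ((H (\<i> * of_real (real n)) - H (- (\<i> * of_real (real n)))) / \<i>)
        + (c * arctan (real n) - c * arctan (- real n))) \<longlonglongrightarrow> 0 + (c * (pi / 2) - c * (- (pi / 2)))"
      by (rule tendsto_add)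
    then show ?thesis
      by (rule back_subst[where P = "\<lambda>u. u \<longlonglongrightarrow> _"]) (auto simp: G_def diff_divide_distrib)
  qed
  then have "(\<lambda>n. G (real n) - G (- real n)) \<longlonglongrightarrow> pi * c"
    by (simp add: mult.commute)
  then show ?thesis
    by (intro has_bochner_integral_exhaustion[OF G f_cont nonneg])
qed

subsection \<open>Complex matrices and their inverses\<close>

abbreviation cmatrix :: "real^'n^'m \<Rightarrow> complex^'n^'m"
  where "cmatrix \<equiv> map_matrix complex_of_real"

lemma cmatrix_mult: "cmatrix (M ** N) = cmatrix M ** cmatrix N"
  by (simp add: vec_eq_iff matrix_matrix_mult_def)

lemma cmatrix_add: "cmatrix (M + N) = cmatrix M + cmatrix N"
  by (simp add: vec_eq_iff)

lemma cmatrix_0: "cmatrix 0 = 0"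
  by (simp add: vec_eq_iff)

text \<open>On complex vectors the inner product of the library is real-valued, namely the real part
  of the Hermitian one; for a real matrix the adjoint is therefore the plain transpose.\<close>

lemma inner_cmatrix_mult: "(cmatrix M *v u) \<bullet> v = u \<bullet> (cmatrix (transpose M) *v v)"
proof -
  have "(cmatrix M *v u) \<bullet> v = (\<Sum>i\<in>UNIV. \<Sum>j\<in>UNIV. M $ i $ j * (u $ j \<bullet> v $ i))"
    by (simp add: inner_vec_def matrix_vector_mult_def inner_sum_left algebra_simps inner_complex_def sum_distrib_left sum.distrib)
  also have "\<dots> = (\<Sum>j\<in>UNIV. \<Sum>i\<in>UNIV. M $ i $ j * (u $ j \<bullet> v $ i))"
    by (rule sum.swap)
  also have "\<dots> = u \<bullet> (cmatrix (transpose M) *v v)"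
    by (simp add: inner_vec_def matrix_vector_mult_def inner_sum_right algebra_simps inner_complex_def sum_distrib_left sum.distrib transpose_def del: transpose_matrix_vector)
  finally show ?thesis .
qed

lemma cmatrix_mult_Re: "(\<chi> i. Re ((cmatrix M *v v) $ i)) = M *v (\<chi> j. Re (v $ j))"
  by (simp add: vec_eq_iff matrix_vector_mult_def)

lemma cmatrix_mult_Im: "(\<chi> i. Im ((cmatrix M *v v) $ i)) = M *v (\<chi> j. Im (v $ j))"
  by (simp add: vec_eq_iff matrix_vector_mult_def)

lemma inner_cvec_Re_Im:
  "(u :: complex^'n) \<bullet> v = (\<chi> i. Re (u $ i)) \<bullet> (\<chi> i. Re (v $ i)) + (\<chi> i. Im (u $ i)) \<bullet> (\<chi> i. Im (v $ i))"
  by (simp add: inner_vec_def inner_complex_def sum.distrib)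

lemma mat_minus_mult: "(mat s - M) *v v = s *s v - M *v (v :: complex^'n)"
  by (simp add: matrix_vector_mult_diff_rdistrib)
     (simp add: vec_eq_iff matrix_vector_mult_def mat_def if_distrib if_distribR cong: if_cong)

text \<open>The inner product is only real-linear, so a complex factor splits into a real scaling
  and a multiple of multiplication by i, which \<open>inner_i_mult\<close> shows to be skew.\<close>

lemma inner_scalar_mult_complex:
  fixes u v :: "complex^'n"
  shows "u \<bullet> (s *s v) = Re s * (u \<bullet> v) + Im s * (u \<bullet> (\<i> *s v))"
  by (simp add: inner_vec_def inner_complex_def algebra_simps sum.distrib sum_distrib_left sum_subtractf)

lemma inner_i_mult: "(u :: complex^'n) \<bullet> (\<i> *s v) = - ((\<i> *s u) \<bullet> v)"
  by (simp add: inner_vec_def inner_complex_def sum.distrib sum_negf sum_subtractf)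

lemma norm_scalar_mult_complex: "norm (s *s (v :: complex^'n)) = norm s * norm v"
  by (simp add: norm_vec_def L2_set_def norm_mult power_mult_distrib real_sqrt_mult flip: sum_distrib_left)

lemma matrix_inv_right: "invertible (M :: 'a::semiring_1^'n^'n) \<Longrightarrow> M ** matrix_inv M = mat 1"
  and matrix_inv_left: "invertible M \<Longrightarrow> matrix_inv M ** M = mat 1"
  using someI_ex[of "\<lambda>N. M ** N = mat 1 \<and> N ** M = mat 1"]
  by (auto simp: invertible_def matrix_inv_def)

lemma matrix_inv_unique:
  assumes "(M :: 'a::semiring_1^'n^'n) ** N = mat 1" "N ** M = mat 1"
  shows "matrix_inv M = N"
proof -
  have "invertible M"
    using assms by (auto simp: invertible_def)
  then show ?thesis
    by (metis assms(1) matrix_inv_left matrix_mul_assoc matrix_mul_lid matrix_mul_rid)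
qed

section \<open>Analyticity and conjugation symmetry of matrix inverses\<close>

lemma holomorphic_on_det [holomorphic_intros]:
  fixes M :: "complex \<Rightarrow> complex^'n^'n"
  assumes "\<And>i j. (\<lambda>s. M s $ i $ j) holomorphic_on S"
  shows "(\<lambda>s. det (M s)) holomorphic_on S"
  unfolding det_def by (intro holomorphic_intros assms)

text \<open>By Cramer's rule each component is a quotient of determinants, with a denominator that
  has no zero on \<open>S\<close>.\<close>

lemma holomorphic_on_matrix_inv_mult:
  fixes M :: "complex \<Rightarrow> complex^'n^'n"
  assumes M: "\<And>i j. (\<lambda>s. M s $ i $ j) holomorphic_on S"
    and inv: "\<And>s. s \<in> S \<Longrightarrow> invertible (M s)"
  shows "(\<lambda>s. (matrix_inv (M s) *v u) $ k) holomorphic_on S"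
proof -
  have "(matrix_inv (M s) *v u) $ k = det (\<chi> i j. if j = k then u $ i else M s $ i $ j) / det (M s)"
    if "s \<in> S" for s
  proof -
    have "M s *v (matrix_inv (M s) *v u) = u"
      using inv[OF that] by (simp add: matrix_vector_mul_assoc matrix_inv_right)
    then show ?thesis
      using cramer[of "M s" "matrix_inv (M s) *v u" u] inv[OF that]
      by (simp add: invertible_det_nz vec_eq_iff)
  qed
  moreover have "(\<lambda>s. det (\<chi> i j. if j = k then u $ i else M s $ i $ j) / det (M s)) holomorphic_on S"
  proof (intro holomorphic_intros M)
    show "(\<lambda>s. (\<chi> i j. if j = k then u $ i else M s $ i $ j) $ i $ j) holomorphic_on S" for i j
      using M by (cases "j = k") auto
    show "det (M s) \<noteq> 0" if "s \<in> S" for s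
      using inv[OF that] by (simp add: invertible_det_nz)
  qed
  ultimately show ?thesis
    by (simp cong: holomorphic_cong)
qed

lemma cnj_matrix_inv:
  fixes M :: "complex^'n^'n"
  assumes "invertible M"
  shows "matrix_inv (map_matrix cnj M) = map_matrix cnj (matrix_inv M)"
proof (rule matrix_inv_unique)
  have mult: "map_matrix cnj N ** map_matrix cnj N' = map_matrix cnj (N ** N')" for N N' :: "complex^'n^'n"
    by (simp add: vec_eq_iff matrix_matrix_mult_def)
  have one: "map_matrix cnj (mat 1) = (mat 1 :: complex^'n^'n)"
    by (simp add: vec_eq_iff mat_def)
  show "map_matrix cnj M ** map_matrix cnj (matrix_inv M) = mat 1"
    "map_matrix cnj (matrix_inv M) ** map_matrix cnj M = mat 1"
    by (simp_all add: mult one matrix_inv_left matrix_inv_right assms)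
qed

text \<open>The system matrices are real, so conjugation passes through sums, products and the
  inverse. On the imaginary axis this turns the transpose of G(-iw) into the Hermitian adjoint of
  G(iw).\<close>

lemma transfer_function_cnj:
  assumes "invertible (mat s - cmatrix A)"
  shows "transfer_function A B C (cnj s) = map_matrix cnj (transfer_function A B C s)"
proof -
  have pencil: "mat (cnj s) - cmatrix A = map_matrix cnj (mat s - cmatrix A)"
    by (simp add: vec_eq_iff mat_def)
  show ?thesis
    unfolding transfer_function_def pencil cnj_matrix_inv[OF assms]
    by (simp add: vec_eq_iff matrix_matrix_mult_def)
qed

lemma norm_power2_cvec: "(norm (v :: complex^'n))\<^sup>2 = (\<Sum>i\<in>UNIV. (norm (v $ i))\<^sup>2)"
  by (simp add: norm_vec_def L2_set_def sum_nonneg)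

lemma trace_sandwich:
  fixes P :: "real^'n^'n" and B :: "real^'m^'n"
  shows "trace (transpose B ** P ** B) = (\<Sum>j\<in>UNIV. column j B \<bullet> (P *v column j B))"
proof -
  have "(transpose B ** P ** B) $ j $ j = column j B \<bullet> (P *v column j B)" for j
  proof -
    have "(transpose B ** P ** B) $ j $ j = (\<Sum>k\<in>UNIV. \<Sum>i\<in>UNIV. B $ i $ j * P $ i $ k * B $ k $ j)"
      by (simp add: matrix_matrix_mult_def transpose_def sum_distrib_right)
    also have "\<dots> = (\<Sum>i\<in>UNIV. \<Sum>k\<in>UNIV. B $ i $ j * P $ i $ k * B $ k $ j)"
      by (rule sum.swap)
    also have "\<dots> = column j B \<bullet> (P *v column j B)"
      by (simp add: column_def inner_vec_def matrix_vector_mult_def sum_distrib_left mult.assoc)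
    finally show ?thesis .
  qed
  then show ?thesis
    by (simp add: trace_def)
qed

subsection \<open>Systems with a Lyapunov equation\<close>

text \<open>A Lyapunov equation for the stacked output (C, E). Stability of \<open>A\<close> is not
  assumed but derived: \<open>kernel\<close> makes the stacked output injective on states, so every
  nonzero state dissipates. \<open>E\<close> is kept apart from \<open>C\<close> so that the two
  output energies can be separated at the end.\<close>

locale lyapunov_system =
  fixes A P :: "real^'s^'s" and C :: "real^'s^'p" and E :: "real^'s^'q"
  assumes P_psd: "pos_semidefinite P"
    and lyapunov: "transpose A ** P + P ** A + transpose C ** C + transpose E ** E = 0"
    and kernel: "\<And>v. C *v v = 0 \<Longrightarrow> E *v v = 0 \<Longrightarrow> v = 0"
begin

abbreviation "pencil s \<equiv> mat s - cmatrix A"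

abbreviation "response s u \<equiv> matrix_inv (pencil s) *v u"

section \<open>Dissipation and invertibility of the pencil\<close>

lemma P_sym: "transpose P = P"
  using P_psd by (simp add: pos_semidefinite_def)

text \<open>The frequency-domain dissipation identity. The Lyapunov equation replaces the
  contribution of \<open>A\<close> by the output energies, and the imaginary part of s drops out
  because \<open>P\<close> is symmetric. On the imaginary axis the storage term vanishes
  too.\<close>

lemma energy:
  "2 * ((cmatrix P *v v) \<bullet> (pencil s *v v))
     = 2 * Re s * (v \<bullet> (cmatrix P *v v)) + (norm (cmatrix C *v v))\<^sup>2 + (norm (cmatrix E *v v))\<^sup>2"
proof -
  have P_swap: "(cmatrix P *v u) \<bullet> w = u \<bullet> (cmatrix P *v w)" for u w
    by (simp add: inner_cmatrix_mult P_sym del: transpose_matrix_vector)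
  \<comment> \<open>Multiplication by i is skew and commutes with the symmetric \<open>P\<close>, so
    this number equals its own negative.\<close>
  have "(cmatrix P *v v) \<bullet> (\<i> *s v) = - ((cmatrix P *v v) \<bullet> (\<i> *s v))"
    by (metis P_swap inner_commute inner_i_mult vector_scalar_commute)
  then have skew: "(cmatrix P *v v) \<bullet> (\<i> *s v) = 0"
    by simp
  \<comment> \<open>The Lyapunov equation is tested against v; moving the transposes across makes
    its first two terms coincide and turns the last two into squared norms.\<close>
  have "cmatrix (transpose A ** P + P ** A + transpose C ** C + transpose E ** E) *v v = 0"
    by (simp add: lyapunov cmatrix_0)
  then have "v \<bullet> (cmatrix (transpose A) *v (cmatrix P *v v)) + v \<bullet> (cmatrix P *v (cmatrix A *v v))
      + v \<bullet> (cmatrix (transpose C) *v (cmatrix C *v v)) + v \<bullet> (cmatrix (transpose E) *v (cmatrix E *v v)) = 0"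
    by (simp add: cmatrix_add cmatrix_mult matrix_vector_mult_add_rdistrib
        inner_add_right[symmetric] matrix_vector_mul_assoc del: transpose_matrix_vector)
  then have "2 * ((cmatrix P *v v) \<bullet> (cmatrix A *v v))
      = - (norm (cmatrix C *v v))\<^sup>2 - (norm (cmatrix E *v v))\<^sup>2"
    by (simp add: inner_cmatrix_mult[symmetric] P_swap[of v, symmetric] power2_norm_eq_inner
        inner_commute[of "cmatrix A *v v"] del: transpose_matrix_vector)
  then show ?thesis
    unfolding mat_minus_mult
    by (simp add: inner_diff_right inner_scalar_mult_complex[of _ s] skew
        inner_commute[of v] algebra_simps del: transpose_matrix_vector)
qed

lemma P_form_nonneg: "v \<bullet> (cmatrix P *v v) \<ge> 0"
  using P_psd by (simp add: inner_cvec_Re_Im cmatrix_mult_Re cmatrix_mult_Im pos_semidefinite_def)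

lemma kernel_complex:
  assumes "cmatrix C *v v = 0" "cmatrix E *v v = 0"
  shows "v = 0"
proof -
  have "C *v (\<chi> i. Re (v $ i)) = 0" "E *v (\<chi> i. Re (v $ i)) = 0"
    "C *v (\<chi> i. Im (v $ i)) = 0" "E *v (\<chi> i. Im (v $ i)) = 0"
    unfolding cmatrix_mult_Re[symmetric] cmatrix_mult_Im[symmetric] assms by (simp_all add: vec_eq_iff)
  then have "(\<chi> i. Re (v $ i)) = 0" "(\<chi> i. Im (v $ i)) = 0"
    using kernel by blast+
  then show ?thesis
    by (simp add: vec_eq_iff complex_eq_iff)
qed

text \<open>An injective linear map on a finite-dimensional space is bounded below.\<close>

lemma coercive:
  obtains m where "m > 0"
    and "\<And>v. m * (norm v)\<^sup>2 \<le> (norm (cmatrix C *v v))\<^sup>2 + (norm (cmatrix E *v v))\<^sup>2"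
proof -
  let ?f = "\<lambda>v. (cmatrix C *v v, cmatrix E *v v)"
  have lin: "linear ?f"
    by (intro linearI) (simp_all add: matrix_vector_right_distrib linear_cmul[OF matrix_vector_mul_linear])
  have "inj ?f"
    unfolding linear_injective_0[OF lin] by (auto intro: kernel_complex simp: zero_prod_def)
  then obtain b where b: "b > 0" "\<And>v. b * norm v \<le> norm (?f v)"
    using linear_inj_bounded_below_pos[OF lin] by blast
  have "b\<^sup>2 * (norm v)\<^sup>2 \<le> (norm (cmatrix C *v v))\<^sup>2 + (norm (cmatrix E *v v))\<^sup>2" for v
  proof -
    have "(b * norm v)\<^sup>2 \<le> (norm (?f v))\<^sup>2"
      using b by (intro power_mono) auto
    then show ?thesis
      by (simp add: norm_Pair power_mult_distrib)
  qed
  then show ?thesis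
    using that[of "b\<^sup>2"] b by simp
qed

text \<open>For a kernel vector the left side of \<open>energy\<close> vanishes while the right side
  is a sum of nonnegative terms, so both outputs are zero. In other words, \<open>A\<close> is
  Hurwitz.\<close>

lemma invertible_pencil:
  assumes "Re s \<ge> 0"
  shows "invertible (pencil s)"
proof -
  have "v = 0" if "pencil s *v v = 0" for v
  proof -
    have "2 * Re s * (v \<bullet> (cmatrix P *v v)) \<ge> 0"
      using assms P_form_nonneg by simp
    then have "(norm (cmatrix C *v v))\<^sup>2 + (norm (cmatrix E *v v))\<^sup>2 \<le> 0"
      using energy[of v s] that by simp
    then have "cmatrix C *v v = 0" "cmatrix E *v v = 0"
      by (simp_all add: sum_power2_le_zero_iff)
    then show ?thesis
      by (rule kernel_complex)
  qed
  then show ?thesis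
    by (metis invertible_left_inverse matrix_left_invertible_ker)
qed

section \<open>Bounds and asymptotics of the resolvent\<close>

lemma pencil_response: "Re s \<ge> 0 \<Longrightarrow> pencil s *v response s u = u"
  by (simp add: matrix_vector_mul_assoc matrix_inv_right invertible_pencil)

lemma response_eqI:
  assumes "Re s \<ge> 0" "pencil s *v v = u"
  shows "response s u = v"
  using assms by (metis invertible_pencil matrix_inv_left matrix_vector_mul_assoc matrix_vector_mul_lid)

lemma energy_response:
  assumes "Re s \<ge> 0"
  shows "(norm (cmatrix C *v response s u))\<^sup>2 + (norm (cmatrix E *v response s u))\<^sup>2
    \<le> 2 * ((cmatrix P *v response s u) \<bullet> u)"
  using energy[of "response s u" s] assms P_form_nonneg[of "response s u"] by (simp add: pencil_response)

lemma energy_response_imaginary: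
  "(norm (cmatrix C *v response (\<i> * of_real w) u))\<^sup>2 + (norm (cmatrix E *v response (\<i> * of_real w) u))\<^sup>2
    = 2 * ((cmatrix P *v response (\<i> * of_real w) u) \<bullet> u)"
  using energy[of "response (\<i> * of_real w) u" "\<i> * of_real w"] by (simp add: pencil_response)

text \<open>Coercivity and \<open>energy_response\<close> bound the squared norm of the response
  linearly in its norm, by Cauchy-Schwarz after moving \<open>P\<close> onto u; one factor then
  cancels. The bound is uniform up to the imaginary axis.\<close>

lemma response_bounded:
  obtains K where "\<And>s. Re s \<ge> 0 \<Longrightarrow> norm (response s u) \<le> K"
proof -
  obtain m where m: "m > 0"
    "\<And>v. m * (norm v)\<^sup>2 \<le> (norm (cmatrix C *v v))\<^sup>2 + (norm (cmatrix E *v v))\<^sup>2"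
    using coercive by blast
  have "norm (response s u) \<le> 2 * norm (cmatrix P *v u) / m" if s: "Re s \<ge> 0" for s
  proof (cases "response s u = 0")
    case False
    have "m * (norm (response s u))\<^sup>2 \<le> 2 * ((cmatrix P *v response s u) \<bullet> u)"
      using m(2) energy_response[OF s] by (rule order_trans)
    also have "\<dots> = 2 * (response s u \<bullet> (cmatrix P *v u))"
      by (simp add: inner_cmatrix_mult P_sym del: transpose_matrix_vector)
    also have "\<dots> \<le> 2 * (norm (response s u) * norm (cmatrix P *v u))"
      using norm_cauchy_schwarz by simp
    finally show ?thesis
      using False m(1) by (simp add: field_simps power2_eq_square)
  qed (use m in simp)
  then show ?thesis
    by (rule that)
qed

text \<open>The resolvent equation reads s \<xi> - u = A \<xi>. With k bounding \<open>A\<close> and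
  |s| at least 2 k, the term A \<xi> is absorbed into half of s \<xi>, so \<xi> is O(1 / |s|), and
  hence so is A \<xi>.\<close>

lemma response_decay:
  obtains r K where "r > 0" "K \<ge> 0"
    and "\<And>s. Re s \<ge> 0 \<Longrightarrow> norm s \<ge> r \<Longrightarrow> norm (s *s response s u - u) \<le> K / norm s"
proof -
  obtain k where k: "k > 0" "\<And>v. norm (cmatrix A *v v) \<le> k * norm v"
    using bounded_linear.pos_bounded[OF matrix_vector_mul_bounded_linear, of "cmatrix A"]
    by (auto simp: mult.commute)
  have "norm (s *s response s u - u) \<le> 2 * k * norm u / norm s" if s: "Re s \<ge> 0" "norm s \<ge> 2 * k" for s
  proof -
    have pos: "norm s > 0"
      using s k by linarith
    have eq: "s *s response s u - u = cmatrix A *v response s u"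
      using pencil_response[OF s(1), of u] by (simp add: mat_minus_mult diff_eq_eq)
    then have "s *s response s u = cmatrix A *v response s u + u"
      by (simp add: diff_eq_eq)
    then have "norm s * norm (response s u) = norm (cmatrix A *v response s u + u)"
      by (metis norm_scalar_mult_complex)
    also have "\<dots> \<le> k * norm (response s u) + norm u"
      using norm_triangle_le k(2) add_right_mono by blast
    also have "\<dots> \<le> norm s / 2 * norm (response s u) + norm u"
      using s by (intro add_right_mono mult_right_mono) auto
    finally have "norm (response s u) \<le> 2 * norm u / norm s"
      using pos by (simp add: field_simps)
    then have "k * norm (response s u) \<le> k * (2 * norm u / norm s)"
      by (rule mult_left_mono) (use k in simp)
    with k(2) show ?thesis
      unfolding eq by (rule order_trans[THEN order_trans]) (simp add: mult_ac)
  qed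
  then show ?thesis
    using that[of "2 * k" "2 * k * norm u"] k by simp
qed

lemma holomorphic_response: "(\<lambda>s. response s u $ k) holomorphic_on {s. Re s \<ge> 0}"
proof (rule holomorphic_on_matrix_inv_mult)
  show "(\<lambda>s. pencil s $ i $ j) holomorphic_on {s. Re s \<ge> 0}" for i j
    by (cases "i = j") (auto simp: mat_def intro!: holomorphic_intros)
qed (simp add: invertible_pencil)

lemma continuous_response: "continuous_on UNIV (\<lambda>w. response (\<i> * of_real w) u)"
proof -
  have "continuous_on UNIV (\<lambda>w. response (\<i> * of_real w) u $ k)" for k
    by (intro continuous_on_compose2[OF holomorphic_on_imp_continuous_on[OF holomorphic_response]]
          continuous_intros) auto
  from continuous_on_vec_lambda[of UNIV "\<lambda>k w. response (\<i> * of_real w) u $ k", OF this]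
  show ?thesis
    unfolding vec_lambda_eta .
qed

text \<open>One input channel: the dissipation identity makes the output energy on the axis twice
  the real part of a holomorphic function with leading term (b^T P b) / s, to which the contour
  lemma applies.\<close>

lemma has_bochner_integral_response_energy:
  fixes b :: "real^'s"
  defines "u \<equiv> \<chi> i. complex_of_real (b $ i)"
  shows "has_bochner_integral lborel
    (\<lambda>w. (norm (cmatrix C *v response (\<i> * of_real w) u))\<^sup>2
        + (norm (cmatrix E *v response (\<i> * of_real w) u))\<^sup>2)
    (2 * pi * (b \<bullet> (P *v b)))"
proof -
  define y where "y = P *v b"
  \<comment> \<open>The pairing is bilinear, without conjugation, so \<open>f\<close> is
    holomorphic; since y is real, its real part is still the inner product in the energy
    identity.\<close>
  define f where "f s = (\<Sum>i\<in>UNIV. of_real (y $ i) * response s u $ i)" for s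
  define c where "c = b \<bullet> y"
  have f_eq: "Re (f s) = (cmatrix P *v response s u) \<bullet> u" for s
  proof -
    have "cmatrix P *v u = (\<chi> i. of_real (y $ i))"
      by (simp add: y_def u_def vec_eq_iff matrix_vector_mult_def)
    then have "(cmatrix P *v response s u) \<bullet> u = response s u \<bullet> (\<chi> i. of_real (y $ i))"
      by (simp add: inner_cmatrix_mult P_sym del: transpose_matrix_vector)
    then show ?thesis
      by (simp add: f_def inner_vec_def inner_complex_def mult.commute)
  qed
  obtain r K where r: "r > 0" and K: "K \<ge> 0"
    and decay: "\<And>s. Re s \<ge> 0 \<Longrightarrow> norm s \<ge> r \<Longrightarrow> norm (s *s response s u - u) \<le> K / norm s"
    using response_decay[of u] by blast
  have f_decay: "norm (f s - of_real c / s) \<le> ((\<Sum>i\<in>UNIV. \<bar>y $ i\<bar>) * K) / (norm s)\<^sup>2"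
    if s: "Re s \<ge> 0" "norm s \<ge> r" for s
  proof -
    have s0: "s \<noteq> 0"
      using s r by auto
    have "s * f s - of_real c = (\<Sum>i\<in>UNIV. of_real (y $ i) * (s *s response s u - u) $ i)"
      by (simp add: f_def c_def inner_vec_def u_def algebra_simps sum_distrib_left sum_subtractf)
    also have "norm \<dots> \<le> (\<Sum>i\<in>UNIV. \<bar>y $ i\<bar> * (K / norm s))"
    proof (rule sum_norm_le)
      fix i
      have "norm ((s *s response s u - u) $ i) \<le> K / norm s"
        using Finite_Cartesian_Product.norm_nth_le decay[OF s] by (rule order_trans)
      then show "norm (of_real (y $ i) * (s *s response s u - u) $ i) \<le> \<bar>y $ i\<bar> * (K / norm s)"
        unfolding norm_mult norm_of_real by (rule mult_left_mono) simp
    qed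
    finally have "norm (s * f s - of_real c) \<le> (\<Sum>i\<in>UNIV. \<bar>y $ i\<bar>) * K / norm s"
      by (simp add: sum_distrib_right sum_divide_distrib)
    moreover have "f s - of_real c / s = (s * f s - of_real c) / s"
      using s0 by (simp add: field_simps)
    ultimately show ?thesis
      using s0 by (simp add: norm_divide power2_eq_square field_simps)
  qed
  have "has_bochner_integral lborel (\<lambda>w. Re (f (\<i> * of_real w))) (pi * c)"
  proof (rule has_bochner_integral_Re_imaginary_axis[OF _ f_decay r])
    show "f holomorphic_on {s. Re s \<ge> 0}"
      unfolding f_def by (intro holomorphic_intros holomorphic_response)
    show "0 \<le> (\<Sum>i\<in>UNIV. \<bar>y $ i\<bar>) * K"
      using K by (simp add: sum_nonneg)
    show "0 \<le> Re (f (\<i> * of_real w))" for w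
      using energy_response_imaginary[of w u] sum_power2_ge_zero
      unfolding f_eq by (metis zero_le_mult_iff zero_less_numeral not_less_iff_gr_or_eq not_le)
  qed
  then have "has_bochner_integral lborel (\<lambda>w. 2 * Re (f (\<i> * of_real w))) (2 * (pi * c))"
    by (rule has_bochner_integral_mult_right)
  then show ?thesis
    by (simp add: energy_response_imaginary f_eq c_def y_def mult.assoc)
qed

section \<open>Transfer functions and the H2 norms of the two outputs\<close>

lemma transfer_function_entry:
  "transfer_function A B F s $ i $ j
     = (cmatrix F *v response s (\<chi> k. of_real (column j B $ k))) $ i"
proof -
  have "(\<chi> k. of_real (column j B $ k)) = cmatrix B *v axis j 1"
    by (simp add: vec_eq_iff column_def matrix_vector_mult_def axis_def if_distrib cong: if_cong)
  then have "(cmatrix F *v response s (\<chi> k. of_real (column j B $ k))) $ i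
      = (transfer_function A B F s *v axis j 1) $ i"
    by (simp add: transfer_function_def matrix_vector_mul_assoc matrix_mul_assoc)
  then show ?thesis
    by (simp add: matrix_vector_mult_def axis_def if_distrib cong: if_cong)
qed

text \<open>The resolvent itself is bounded on the closed right half plane, so every choice of input
  and output matrices inherits stability.\<close>

lemma io_stable: "io_stable A B F"
proof -
  have "\<exists>K. \<forall>s. Re s \<ge> 0 \<longrightarrow> norm (transfer_function A B F s $ i $ j) \<le> K" for i j
  proof -
    let ?u = "\<chi> k. complex_of_real (column j B $ k)"
    obtain K where K: "\<And>s. Re s \<ge> 0 \<Longrightarrow> norm (response s ?u) \<le> K"
      using response_bounded by blast
    obtain k where k: "k > 0" "\<And>v. norm (cmatrix F *v v) \<le> norm v * k"
      using bounded_linear.pos_bounded[OF matrix_vector_mul_bounded_linear, of "cmatrix F"] by blast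
    have "norm (transfer_function A B F s $ i $ j) \<le> K * k" if "Re s \<ge> 0" for s
    proof -
      have "norm (transfer_function A B F s $ i $ j) \<le> norm (cmatrix F *v response s ?u)"
        unfolding transfer_function_entry by (rule Finite_Cartesian_Product.norm_nth_le)
      also have "\<dots> \<le> norm (response s ?u) * k"
        by (rule k)
      also have "\<dots> \<le> K * k"
        using K[OF that] k by simp
      finally show ?thesis .
    qed
    then show ?thesis
      by blast
  qed
  then obtain K where K: "\<And>i j s. Re s \<ge> 0 \<Longrightarrow> norm (transfer_function A B F s $ i $ j) \<le> K i j"
    by metis
  have "norm (transfer_function A B F s) \<le> (\<Sum>i\<in>UNIV. \<Sum>j\<in>UNIV. K i j)" if "Re s \<ge> 0" for s
  proof -
    have "norm (transfer_function A B F s) \<le> (\<Sum>i\<in>UNIV. norm (transfer_function A B F s $ i))"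
      unfolding norm_vec_def[of "transfer_function A B F s"] by (rule L2_set_le_sum) simp
    also have "\<dots> \<le> (\<Sum>i\<in>UNIV. \<Sum>j\<in>UNIV. norm (transfer_function A B F s $ i $ j))"
      by (intro sum_mono) (simp add: norm_vec_def L2_set_le_sum)
    also have "\<dots> \<le> (\<Sum>i\<in>UNIV. \<Sum>j\<in>UNIV. K i j)"
      by (intro sum_mono K that)
    finally show ?thesis .
  qed
  then show ?thesis
    unfolding io_stable_def bounded_iff by blast
qed

text \<open>The squared Frobenius norm of the transfer function at iw, summed by input columns to
  match the single-channel results.\<close>

definition output_energy :: "real^'m^'s \<Rightarrow> real^'s^'f \<Rightarrow> real \<Rightarrow> real"
  where "output_energy B F w
    = (\<Sum>j\<in>UNIV. (norm (cmatrix F *v response (\<i> * of_real w) (\<chi> k. of_real (column j B $ k))))\<^sup>2)"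

lemma output_energy_nonneg: "output_energy B F w \<ge> 0"
  by (simp add: output_energy_def sum_nonneg)

lemma continuous_output_energy: "continuous_on UNIV (output_energy B F)"
  unfolding output_energy_def
  by (intro continuous_intros
        continuous_on_compose2[OF matrix_vector_mult_linear_continuous_on continuous_response]) auto

lemma output_energy_eq_trace:
  "Re (trace (transpose (transfer_function A B F (- (\<i> * of_real w))) **
        transfer_function A B F (\<i> * of_real w))) = output_energy B F w"
proof -
  have "transfer_function A B F (- (\<i> * of_real w)) = map_matrix cnj (transfer_function A B F (\<i> * of_real w))"
    using transfer_function_cnj[of "\<i> * of_real w" A B F] invertible_pencil[of "\<i> * of_real w"] by simp
  then have "Re (trace (transpose (transfer_function A B F (- (\<i> * of_real w))) **
        transfer_function A B F (\<i> * of_real w)))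
      = (\<Sum>j\<in>UNIV. \<Sum>i\<in>UNIV. (norm (transfer_function A B F (\<i> * of_real w) $ i $ j))\<^sup>2)"
    by (simp add: trace_def matrix_matrix_mult_def transpose_def cmod_power2 flip: power2_eq_square)
  then show ?thesis
    by (simp add: output_energy_def norm_power2_cvec transfer_function_entry)
qed

lemma H2_norm_power2: "(H2_norm A B F)\<^sup>2 = 1 / (2 * pi) * (LBINT w. output_energy B F w)"
  unfolding H2_norm_def output_energy_eq_trace
  by (simp add: integral_nonneg output_energy_nonneg)

lemma has_bochner_integral_output_energy:
  "has_bochner_integral lborel (\<lambda>w. output_energy B C w + output_energy B E w)
     (2 * pi * trace (transpose B ** P ** B))"
  unfolding output_energy_def sum.distrib[symmetric] trace_sandwich sum_distrib_left
  by (intro has_bochner_integral_sum has_bochner_integral_response_energy)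

text \<open>Each summand is nonnegative and dominated by the integrable sum. This permits splitting
  the integral.\<close>

lemma integrable_output_energy:
  "integrable lborel (output_energy B C)" "integrable lborel (output_energy B E)"
proof -
  have "integrable lborel (\<lambda>w. output_energy B C w + output_energy B E w)"
    using has_bochner_integral_output_energy[of B] by (simp add: has_bochner_integral_iff)
  then show "integrable lborel (output_energy B C)" "integrable lborel (output_energy B E)"
    by (rule Bochner_Integration.integrable_bound;
        simp add: borel_measurable_continuous_onI[OF continuous_output_energy] output_energy_nonneg)+
qed

lemma H2_norm_sum: "(H2_norm A B C)\<^sup>2 + (H2_norm A B E)\<^sup>2 = trace (transpose B ** P ** B)"
proof -
  have "(LBINT w. output_energy B C w) + (LBINT w. output_energy B E w) = 2 * pi * trace (transpose B ** P ** B)"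
    using has_bochner_integral_integral_eq[OF has_bochner_integral_output_energy]
    by (simp add: integrable_output_energy)
  then show ?thesis
    unfolding H2_norm_power2 distrib_left[symmetric] by simp
qed

text \<open>By continuity the energy density is nonzero on an open set around w, which is not a null
  set, so the integral of this nonnegative density is positive.\<close>

lemma H2_norm_pos:
  assumes "transfer_function A B E (\<i> * of_real w) \<noteq> 0"
  shows "(H2_norm A B E)\<^sup>2 > 0"
proof -
  obtain i j where "transfer_function A B E (\<i> * of_real w) $ i $ j \<noteq> 0"
    using assms by (auto simp: vec_eq_iff)
  then have "cmatrix E *v response (\<i> * of_real w) (\<chi> k. of_real (column j B $ k)) \<noteq> 0"
    unfolding transfer_function_entry by auto
  then have "0 < (norm (cmatrix E *v response (\<i> * of_real w) (\<chi> k. of_real (column j B $ k))))\<^sup>2"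
    by simp
  also have "\<dots> \<le> output_energy B E w"
    unfolding output_energy_def by (rule member_le_sum) auto
  finally have "w \<in> {w. output_energy B E w \<noteq> 0}"
    by simp
  moreover have "open {w. output_energy B E w \<noteq> 0}"
    by (intro open_Collect_neq continuous_output_energy continuous_on_const)
  ultimately have non_null: "\<not> negligible {w. output_energy B E w \<noteq> 0}"
    by (metis empty_iff open_not_negligible)
  have "\<not> (AE w in lborel. output_energy B E w = 0)"
  proof
    assume "AE w in lborel. output_energy B E w = 0"
    then obtain N where "N \<in> null_sets lborel" "{w. output_energy B E w \<noteq> 0} \<subseteq> N"
      unfolding eventually_ae_filter by auto
    then show False
      using non_null by (meson negligible_iff_null_sets negligible_subset null_sets_completionI)
  qed
  then have "(LBINT w. output_energy B E w) \<noteq> 0"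
    by (subst integral_nonneg_eq_0_iff_AE[OF integrable_output_energy(2)]) (simp_all add: output_energy_nonneg)
  moreover have "(LBINT w. output_energy B E w) \<ge> 0"
    by (simp add: integral_nonneg output_energy_nonneg)
  ultimately show ?thesis
    unfolding H2_norm_power2 by simp
qed

text \<open>An equilibrium says (0 - A) v = B h, so the steady-state gain is read off without
  computing an inverse.\<close>

lemma transfer_function_0:
  assumes "A *v v + B *v h = 0"
  shows "transfer_function A B F 0 *v (\<chi> k. of_real (h $ k)) = (\<chi> k. of_real ((F *v v) $ k))"
proof -
  let ?cv = "\<lambda>x. \<chi> k. complex_of_real (x $ k)"
  have cv: "cmatrix M *v ?cv x = ?cv (M *v x)" for M x
    by (simp add: vec_eq_iff matrix_vector_mult_def)
  have "A *v v = - (B *v h)"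
    using assms by (simp add: eq_neg_iff_add_eq_0)
  then have "pencil 0 *v ?cv v = cmatrix B *v ?cv h"
    unfolding mat_minus_mult cv by (simp add: vec_eq_iff)
  then have "response 0 (cmatrix B *v ?cv h) = ?cv v"
    by (intro response_eqI) simp_all
  then show ?thesis
    by (simp add: transfer_function_def cv flip: matrix_vector_mul_assoc)
qed

end

subsection \<open>Block matrices\<close>

lemma block_vec_exhaust:
  obtains u w where "v = block_vec u w"
proof
  show "v = block_vec (\<chi> k. v $ Inl k) (\<chi> k. v $ Inr k)"
    by (simp add: block_vec_def vec_eq_iff split: sum.split)
qed

lemma block_vec_0: "block_vec 0 0 = 0"
  by (simp add: block_vec_def vec_eq_iff split: sum.split)

lemma inner_block_vec:
  "block_vec (u :: real^'m) (w :: real^'n) \<bullet> block_vec u' w' = u \<bullet> u' + w \<bullet> w'"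
  by (simp add: inner_vec_def UNIV_sum_split)

lemmas block_simps = block_mat_def block_row_def block_vec_def vec_eq_iff

lemma block_mat_add:
  "block_mat M11 M12 M21 M22 + block_mat N11 N12 N21 N22
     = block_mat (M11 + N11) (M12 + N12) (M21 + N21) (M22 + N22)"
  by (simp add: block_simps split: sum.split)

lemma block_mat_0: "block_mat 0 0 0 0 = 0"
  by (simp add: block_simps split: sum.split)

lemma block_mat_mult_block_mat:
  "block_mat M11 M12 M21 M22 ** block_mat N11 N12 N21 N22
     = block_mat (M11 ** N11 + M12 ** N21) (M11 ** N12 + M12 ** N22)
                 (M21 ** N11 + M22 ** N21) (M21 ** N12 + M22 ** N22)"
  by (simp add: block_simps matrix_matrix_mult_def UNIV_sum_split split: sum.split)

lemma transpose_block_mat: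
  "transpose (block_mat M11 M12 M21 M22)
     = block_mat (transpose M11) (transpose M21) (transpose M12) (transpose M22)"
  by (simp add: block_simps transpose_def split: sum.split)

lemma transpose_block_row_mult:
  "transpose (block_row M N) ** block_row M' N'
     = block_mat (transpose M ** M') (transpose M ** N') (transpose N ** M') (transpose N ** N')"
  by (simp add: block_simps matrix_matrix_mult_def transpose_def split: sum.split)

lemma trace_block_mat: "trace (block_mat M11 M12 M21 M22) = trace M11 + trace M22"
  by (simp add: trace_def block_simps UNIV_sum_split)

lemma matrix_mult_uminus_left: "(- M) ** N = - (M ** (N :: 'a::ring_1^'k^'n))"
  and matrix_mult_uminus_right: "M ** (- N) = - (M ** (N :: 'a::ring_1^'k^'n))"
  by (simp_all add: vec_eq_iff matrix_matrix_mult_def sum_negf)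

lemma transpose_0: "transpose 0 = 0"
  by (simp add: vec_eq_iff transpose_def)

lemma transpose_uminus: "transpose (- M) = - transpose M"
  by (simp add: vec_eq_iff transpose_def)

lemma trace_transpose: "trace (transpose M) = trace M"
  by (simp add: trace_def transpose_def)

lemma trace_scaleR: "trace (c *\<^sub>R (M :: real^'n^'n)) = c * trace M"
  by (simp add: trace_def sum_distrib_left)

lemma full_row_rank_obtains_preimage:
  fixes M :: "real^'n^'m"
  assumes "full_row_rank M"
  obtains x where "M *v x = y"
  using assms unfolding full_row_rank_def full_rank_surjective by (metis surjD)

subsection \<open>The saddle-point system\<close>

definition saddle_P :: "real^'x^'x \<Rightarrow> real^'r^'r \<Rightarrow> real^('x + 'r)^('x + 'r)"
  where "saddle_P Tx Tn = block_mat ((1 / 2) *\<^sub>R Tx) 0 0 ((1 / 2) *\<^sub>R Tn)"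

definition saddle_E :: "real \<Rightarrow> real^('x::finite + 'r)^'r"
  where "saddle_E eps = block_row 0 (mat (sqrt eps))"

text \<open>Weighting by \<open>saddle_P\<close> cancels the time constants and leaves coupling
  blocks of opposite sign, which disappear once the transpose is added.\<close>

lemma saddle_P_mult_reg_A:
  assumes "pos_definite Tx" "pos_definite Tn"
  shows "saddle_P Tx Tn ** reg_A Q S Tx Tn eps
    = block_mat (- ((1 / 2) *\<^sub>R Q)) (- ((1 / 2) *\<^sub>R transpose S)) ((1 / 2) *\<^sub>R S) (- ((eps / 2) *\<^sub>R mat 1))"
  using assms
  by (simp add: saddle_P_def reg_A_def block_mat_mult_block_mat matrix_mult_uminus_right
      scalar_matrix_assoc[symmetric] matrix_scalar_ac matrix_mul_assoc matrix_inv_right pos_definite_invertible)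

lemma saddle_P_mult_reg_B:
  assumes "pos_definite Tx" "pos_definite Tn"
  shows "saddle_P Tx Tn ** reg_B Tx Tn Wb tb tc
    = block_mat (- ((tc / 2) *\<^sub>R mat 1)) 0 0 (- ((tb / 2) *\<^sub>R Wb))"
  using assms
  by (simp add: saddle_P_def reg_B_def block_mat_mult_block_mat matrix_mult_uminus_right
      scalar_matrix_assoc[symmetric] matrix_scalar_ac matrix_mul_assoc matrix_inv_right pos_definite_invertible)

lemma saddle_P_psd:
  assumes "pos_definite Tx" "pos_definite Tn"
  shows "pos_semidefinite (saddle_P Tx Tn)"
  unfolding pos_semidefinite_def
proof (intro conjI allI)
  show "transpose (saddle_P Tx Tn) = saddle_P Tx Tn"
    using assms by (simp add: saddle_P_def pos_definite_def transpose_block_mat transpose_0 transpose_scalar)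
  fix v :: "real^('a + 'b)"
  obtain u w where v: "v = block_vec u w"
    by (rule block_vec_exhaust)
  have "u \<bullet> (Tx *v u) \<ge> 0" "w \<bullet> (Tn *v w) \<ge> 0"
    using assms unfolding pos_definite_def by (metis inner_zero_left less_eq_real_def)+
  then show "v \<bullet> (saddle_P Tx Tn *v v) \<ge> 0"
    by (simp add: v saddle_P_def block_mat_mult inner_block_vec scaleR_matrix_vector_assoc[symmetric])
qed

text \<open>The symmetric part left after the coupling cancels is -diag(Q, eps I), matched exactly
  by C^T C = Q and E^T E = eps I. Definiteness of \<open>Q\<close> and eps > 0 make the stacked
  output injective.\<close>

lemma lyapunov_system_saddle:
  fixes Q Tx :: "real^'x^'x" and S :: "real^'x^'r" and Tn :: "real^'r^'r"
  assumes Q: "is_diagonal Q" "pos_definite Q" and T: "pos_definite Tx" "pos_definite Tn" and "eps > 0"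
  shows "lyapunov_system (reg_A Q S Tx Tn eps) (saddle_P Tx Tn) (reg_C Q :: real^('x + 'r)^'x) (saddle_E eps)"
proof
  let ?P = "saddle_P Tx Tn" and ?A = "reg_A Q S Tx Tn eps" and ?R = "psd_sqrt Q"
  show psd: "pos_semidefinite ?P"
    using T by (rule saddle_P_psd)
  have R: "transpose ?R = ?R" "?R ** ?R = Q"
    using psd_sqrt_diagonal(1)[OF Q, of ?R] by (auto simp: pos_semidefinite_def)
  have "transpose ?A ** ?P = transpose (?P ** ?A)"
    using psd by (simp add: matrix_transpose_mul pos_semidefinite_def)
  then have 1: "transpose ?A ** ?P + ?P ** ?A = block_mat (- Q) 0 0 (- (eps *\<^sub>R mat 1))"
    using Q(2) unfolding saddle_P_mult_reg_A[OF T]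
    by (simp add: transpose_block_mat block_mat_add transpose_uminus transpose_scalar transpose_mat pos_definite_def)
       (simp add: vec_eq_iff block_mat_def block_row_def block_vec_def mat_def split: sum.split)
  have 2: "transpose (reg_C Q) ** reg_C Q = block_mat Q 0 0 (0 :: real^'r^'r)"
    by (simp add: reg_C_def transpose_block_row_mult R transpose_0)
  have "mat (sqrt eps) = (sqrt eps *\<^sub>R mat 1 :: real^'r^'r)"
    by (simp add: vec_eq_iff mat_def)
  then have "mat (sqrt eps) ** mat (sqrt eps) = (eps *\<^sub>R mat 1 :: real^'r^'r)"
    using \<open>eps > 0\<close> by (simp add: scalar_matrix_assoc[symmetric] matrix_scalar_ac)
  then have 3: "transpose (saddle_E eps) ** saddle_E eps = block_mat (0 :: real^'x^'x) 0 0 (eps *\<^sub>R mat 1 :: real^'r^'r)"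
    by (simp add: saddle_E_def transpose_block_row_mult transpose_mat transpose_0)
  show "transpose ?A ** ?P + ?P ** ?A + transpose (reg_C Q) ** reg_C Q
      + transpose (saddle_E eps) ** saddle_E eps = 0"
    unfolding 1 2 3 by (simp add: block_mat_add block_mat_0)
  fix v :: "real^('x + 'r)"
  assume v: "reg_C Q *v v = 0" "saddle_E eps *v v = 0"
  obtain x n where xn: "v = block_vec x n"
    by (rule block_vec_exhaust)
  have "Q *v x = ?R *v (?R *v x)"
    by (simp add: matrix_vector_mul_assoc R)
  also have "\<dots> = 0"
    using v(1) by (simp add: xn reg_output)
  finally have "x = 0"
    using Q(2) unfolding pos_definite_def by (metis inner_zero_right less_irrefl)
  moreover have "sqrt eps *\<^sub>R n = 0"
    using v(2) unfolding xn saddle_E_def block_row_mult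
    by (simp add: vec_eq_iff matrix_vector_mult_def mat_def if_distrib if_distribR cong: if_cong)
  ultimately show "v = 0"
    using \<open>eps > 0\<close> by (simp add: xn block_vec_0)
qed

lemma trace_saddle_P:
  assumes "pos_definite Tx" "pos_definite Tn"
  shows "trace (transpose (reg_B Tx Tn Wb tb tc) ** saddle_P Tx Tn ** reg_B Tx Tn Wb tb tc)
    = tc\<^sup>2 / 2 * trace (matrix_inv Tx) + tb\<^sup>2 / 2 * trace (transpose Wb ** matrix_inv Tn ** Wb)"
proof -
  \<comment> \<open>\<open>saddle_P\<close> cancels one of the two inverses, leaving this product in
    the lower block; transposing under the trace puts it into the claimed order.\<close>
  have "trace (transpose (matrix_inv Tn ** Wb) ** Wb) = trace (transpose (transpose (matrix_inv Tn ** Wb) ** Wb))"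
    by (simp add: trace_transpose)
  also have "\<dots> = trace (transpose Wb ** matrix_inv Tn ** Wb)"
    by (simp add: matrix_transpose_mul matrix_mul_assoc)
  finally show ?thesis
    unfolding matrix_mul_assoc[symmetric] saddle_P_mult_reg_B[OF assms]
    by (simp add: reg_B_def transpose_block_mat block_mat_mult_block_mat transpose_uminus transpose_scalar
        transpose_0 matrix_mult_uminus_left matrix_mult_uminus_right
        scalar_matrix_assoc[symmetric] matrix_scalar_ac trace_block_mat trace_scaleR trace_transpose power2_eq_square)
qed

text \<open>Whichever disturbance is active can hold the system at rest with a nonzero
  multiplier.\<close>

lemma reg_equilibrium_multiplier_nonzero:
  fixes Q Tx :: "real^'x^'x" and S :: "real^'x^'r" and Wb :: "real^'b^'r" and Tn :: "real^'r^'r"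
  assumes pd: "pos_definite Q" "pos_definite Tx" "pos_definite Tn"
    and S: "full_row_rank S" and Wb: "full_row_rank Wb"
    and t: "tb \<noteq> 0 \<or> tc \<noteq> 0" and eps: "eps > 0"
  obtains x n h where "reg_A Q S Tx Tn eps *v block_vec x n + reg_B Tx Tn Wb tb tc *v h = 0" "n \<noteq> 0"
proof -
  have "\<exists>x n hc hb. Q *v x + transpose S *v n + tc *\<^sub>R hc = 0
      \<and> S *v x = eps *\<^sub>R n + tb *\<^sub>R (Wb *v hb) \<and> n \<noteq> 0"
  proof (cases "tc = 0")
    case False
    \<comment> \<open>The all-ones vector is just a nonzero target. With hb = 0 the second equation
      fixes n, and hc balances the first.\<close>
    obtain x where x: "S *v x = 1"
      using full_row_rank_obtains_preimage[OF S] .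
    define n where "n = (1 / eps) *\<^sub>R (S *v x)"
    define hc where "hc = (- 1 / tc) *\<^sub>R (Q *v x + transpose S *v n)"
    have "Q *v x + transpose S *v n + tc *\<^sub>R hc = 0"
      using False by (simp add: hc_def del: transpose_matrix_vector)
    moreover have "S *v x = eps *\<^sub>R n + tb *\<^sub>R (Wb *v 0)" "n \<noteq> 0"
      using eps by (simp_all add: n_def x)
    ultimately show ?thesis
      by blast
  next
    case True
    \<comment> \<open>Here tb is nonzero: a nonzero n is chosen freely, x solves the first equation,
      and surjectivity of \<open>Wb\<close> supplies hb for the second.\<close>
    define n :: "real^'r" where "n = 1"
    define x where "x = matrix_inv Q *v (- (transpose S *v n))"
    obtain hb where hb: "Wb *v hb = (1 / tb) *\<^sub>R (S *v x - eps *\<^sub>R n)"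
      using full_row_rank_obtains_preimage[OF Wb] .
    have "Q *v x = - (transpose S *v n)"
      using matrix_inv_cancel[OF pos_definite_invertible[OF pd(1)]] x_def by blast
    then have "Q *v x + transpose S *v n + tc *\<^sub>R 0 = 0"
      by simp
    moreover have "S *v x = eps *\<^sub>R n + tb *\<^sub>R (Wb *v hb)" "n \<noteq> 0"
      using t True by (simp_all add: hb n_def)
    ultimately show ?thesis
      by blast
  qed
  then obtain x n hc hb where *: "Q *v x + transpose S *v n + tc *\<^sub>R hc = 0"
      "S *v x = eps *\<^sub>R n + tb *\<^sub>R (Wb *v hb)" "n \<noteq> 0"
    by blast
  have "- (Q *v x) - transpose S *v n - tc *\<^sub>R hc = - (Q *v x + transpose S *v n + tc *\<^sub>R hc)"
    by simp
  also have "\<dots> = 0"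
    unfolding *(1) by simp
  finally have "Tx *v 0 = - (Q *v x) - transpose S *v n - tc *\<^sub>R hc"
    by (simp only: matrix_vector_mult_0_right)
  moreover have "Tn *v 0 = S *v x - eps *\<^sub>R n - tb *\<^sub>R (Wb *v hb)"
    using *(2) by simp
  ultimately have "block_vec 0 0 = reg_A Q S Tx Tn eps *v block_vec x n + reg_B Tx Tn Wb tb tc *v block_vec hc hb"
    using reg_dynamics[OF pd(2,3)] by blast
  then show ?thesis
    using that[of x n "block_vec hc hb"] *(3) by (simp add: block_vec_0)
qed

text \<open>The case tb = tc = 0 is excluded because both sides are then zero and strictness fails.
  Stability is part of the conclusion so that the value of \<open>H2_norm\<close> is
  meaningful.\<close>

theorem mainTheorem2:
  fixes Q Tx :: "real^'x^'x"
    and S :: "real^'x^'r"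
    and Wb :: "real^'b^'r"
    and Tn :: "real^'r^'r"
    and tb tc eps :: real
  assumes "CARD('r) < CARD('x)"
    and "is_diagonal Q" and "pos_definite Q"
    and "full_row_rank S" and "full_row_rank Wb"
    and "is_diagonal Tx" and "pos_definite Tx"
    and "is_diagonal Tn" and "pos_definite Tn"
    and "tb \<ge> 0" and "tc \<ge> 0" and "tb \<noteq> 0 \<or> tc \<noteq> 0"
    and "eps > 0"
  shows "io_stable (reg_A Q S Tx Tn eps) (reg_B Tx Tn Wb tb tc) (reg_C Q) \<and>
    (H2_norm (reg_A Q S Tx Tn eps) (reg_B Tx Tn Wb tb tc) (reg_C Q))\<^sup>2
      < tc\<^sup>2 / 2 * trace (matrix_inv Tx) + tb\<^sup>2 / 2 * trace (transpose Wb ** matrix_inv Tn ** Wb)"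
proof -
  let ?A = "reg_A Q S Tx Tn eps" and ?B = "reg_B Tx Tn Wb tb tc"
  interpret lyapunov_system ?A "saddle_P Tx Tn" "reg_C Q" "saddle_E eps :: real^('x + 'r)^'r"
    using assms by (intro lyapunov_system_saddle)
  obtain x n h where eq: "?A *v block_vec x n + ?B *v h = 0" and "n \<noteq> 0"
    by (rule reg_equilibrium_multiplier_nonzero[OF assms(3,7,9,4,5,12,13)])
  have E_mult: "(saddle_E eps :: real^('x + 'r)^'r) *v block_vec x n = sqrt eps *\<^sub>R n"
    unfolding saddle_E_def block_row_mult
    by (simp add: vec_eq_iff matrix_vector_mult_def mat_def if_distrib if_distribR cong: if_cong)
  \<comment> \<open>The equilibrium with nonzero multiplier gives a nonzero gain to the second
    output at frequency zero; its H2 norm is then the strict gap in the inequality.\<close>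
  have "transfer_function ?A ?B (saddle_E eps :: real^('x + 'r)^'r) 0 \<noteq> 0"
  proof
    assume 0: "transfer_function ?A ?B (saddle_E eps :: real^('x + 'r)^'r) 0 = 0"
    have "sqrt eps *\<^sub>R n = 0"
      using transfer_function_0[OF eq, of "saddle_E eps :: real^('x + 'r)^'r"]
      unfolding 0 E_mult by (simp add: vec_eq_iff)
    then show False
      using \<open>n \<noteq> 0\<close> \<open>eps > 0\<close> by simp
  qed
  then have "(H2_norm ?A ?B (saddle_E eps :: real^('x + 'r)^'r))\<^sup>2 > 0"
    using H2_norm_pos[of ?B 0] by simp
  then have "(H2_norm ?A ?B (reg_C Q))\<^sup>2
      < trace (transpose ?B ** saddle_P Tx Tn ** ?B)"
    using H2_norm_sum[of ?B] by linarith
  then show ?thesis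
    using io_stable assms by (simp add: trace_saddle_P)
qed

end
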